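(* Let $h\in\omega^\omega$. Then: (a) if $h$ diverges to infinity, $\mathrm{minLc}_h=\mathrm{minLc}$ and $\mathrm{supLc}_h=\mathrm{supLc}$; (b) if $h(n)\geq1$ for all but finitely many $n$, then $\mathrm{supaLc}_h=\mathrm{supaLc}$ and $\mathrm{minaLc}_h=\mathrm{minaLc}$.
   Context: A natural number $k$ used as a set means $\{0,\dots,k-1\}$; for $b\in\omega^\omega$ and $h\in\omega^\omega$ let $\prod b=\prod_n b(n)$ and $\mathcal{S}(b,h)=\prod_n[b(n)]^{\leq h(n)}$. Localization cardinals: $\mathfrak{b}^{\mathrm{Lc}}_{b,h}$ is the least size of $F\subseteq\prod b$ such that no $\varphi\in\mathcal{S}(b,h)$ satisfies ($x(n)\in\varphi(n)$ for all but finitely many $n$) for all $x\in F$; $\mathfrak{d}^{\mathrm{Lc}}_{b,h}$ is the least size of $D\subseteq\mathcal{S}(b,h)$ such that each $x\in\prod b$ is eventually in some $\varphi\in D$ in that sense. Say $\varphi$ anti-localizes $y$ if $y(n)\notin\varphi(n)$ for all but finitely many $n$. Anti-localization cardinals: $\mathfrak{b}^{\mathrm{aLc}}_{b,h}$ is the least size of $F\subseteq\mathcal{S}(b,h)$ such that no $y\in\prod b$ is anti-localized by all $\varphi\in F$; $\mathfrak{d}^{\mathrm{aLc}}_{b,h}$ is the least size of $D\subseteq\prod b$ such that every $\varphi\in\mathcal{S}(b,h)$ anti-localizes some $y\in D$. Define $\mathrm{minLc}_h=\min\{\mathfrak{b}^{\mathrm{Lc}}_{b,h}\}$, $\mathrm{supLc}_h=\sup\{\mathfrak{d}^{\mathrm{Lc}}_{b,h}\}$,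 $\mathrm{supaLc}_h=\sup\{\mathfrak{b}^{\mathrm{aLc}}_{b,h}\}$, $\mathrm{minaLc}_h=\min\{\mathfrak{d}^{\mathrm{aLc}}_{b,h}\}$, where $b$ ranges over all $b\in\omega^\omega$ with $h(n)<b(n)$ for all but finitely many $n$. Write $\mathrm{minLc}=\mathrm{minLc}_{\mathrm{id}_\omega}$, $\mathrm{supLc}=\mathrm{supLc}_{\mathrm{id}_\omega}$, $\mathrm{supaLc}=\mathrm{supaLc}_1$, $\mathrm{minaLc}=\mathrm{minaLc}_1$ (with $1$ the constant function). *)

theory Defs
  imports Complex_Main "HOL-Library.Infinite_Set"
begin

unbundle cardinal_syntax

text \<open>
  Cardinals are the library's \<^const>\<open>Card_order\<close> relations, considered up to \<open>=o\<close>.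
  As for \<^const>\<open>isCardSuc\<close> and \<^const>\<open>cardSuc\<close>, minima and suprema are introduced
  by a predicate that determines them up to \<open>=o\<close>.
\<close>

definition isMinCard :: "'a rel set \<Rightarrow> 'a rel \<Rightarrow> bool" where
  "isMinCard R r \<longleftrightarrow> r \<in> R \<and> (\<forall>s\<in>R. r \<le>o s)"

text \<open>
  A set of cardinals on \<open>'a\<close> is bounded by \<open>|UNIV :: 'a set|\<close>, so its supremum exists on
  \<open>'a\<close>, and comparing with upper bounds on \<open>'a\<close> only is no restriction.
\<close>

definition isSupCard :: "'a rel set \<Rightarrow> 'a rel \<Rightarrow> bool" where
  "isSupCard R r \<longleftrightarrow> Card_order r \<and> (\<forall>s\<in>R. s \<le>o r) \<and>
     (\<forall>u :: 'a rel. Card_order u \<and> (\<forall>s\<in>R. s \<le>o u) \<longrightarrow> r \<le>o u)"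

definition minCard :: "'a rel set \<Rightarrow> 'a rel" where
  "minCard R = (SOME r. isMinCard R r)"

definition supCard :: "'a rel set \<Rightarrow> 'a rel" where
  "supCard R = (SOME r. isSupCard R r)"

definition prodb :: "(nat \<Rightarrow> nat) \<Rightarrow> (nat \<Rightarrow> nat) set" where
  "prodb b = {x. \<forall>n. x n \<in> {..<b n}}"

definition slaloms :: "(nat \<Rightarrow> nat) \<Rightarrow> (nat \<Rightarrow> nat) \<Rightarrow> (nat \<Rightarrow> nat set) set" where
  "slaloms b h = {\<phi>. \<forall>n. \<phi> n \<subseteq> {..<b n} \<and> card (\<phi> n) \<le> h n}"

definition localizes :: "(nat \<Rightarrow> nat set) \<Rightarrow> (nat \<Rightarrow> nat) \<Rightarrow> bool" where
  "localizes \<phi> x \<longleftrightarrow> (\<forall>\<^sub>\<infinity>n. x n \<in> \<phi> n)"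

definition antilocalizes :: "(nat \<Rightarrow> nat set) \<Rightarrow> (nat \<Rightarrow> nat) \<Rightarrow> bool" where
  "antilocalizes \<phi> y \<longleftrightarrow> (\<forall>\<^sub>\<infinity>n. y n \<notin> \<phi> n)"

text \<open>
  The four cardinals with parameters \<open>b\<close> and \<open>h\<close> are given as predicates because a least size
  need not exist: if \<open>b n = 0\<close> for some \<open>n\<close>, then \<open>prodb b\<close> is empty and there is no family as
  required in \<open>is_bLc\<close> or \<open>is_daLc\<close>. Such \<open>b\<close> then contribute nothing to the minima below.
\<close>

definition is_bLc :: "(nat \<Rightarrow> nat) \<Rightarrow> (nat \<Rightarrow> nat) \<Rightarrow> (nat \<Rightarrow> nat) rel \<Rightarrow> bool" where
  "is_bLc b h = isMinCard {|F| | F. F \<subseteq> prodb b \<and>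
     \<not> (\<exists>\<phi>\<in>slaloms b h. \<forall>x\<in>F. localizes \<phi> x)}"

definition is_dLc :: "(nat \<Rightarrow> nat) \<Rightarrow> (nat \<Rightarrow> nat) \<Rightarrow> (nat \<Rightarrow> nat set) rel \<Rightarrow> bool" where
  "is_dLc b h = isMinCard {|D| | D. D \<subseteq> slaloms b h \<and>
     (\<forall>x\<in>prodb b. \<exists>\<phi>\<in>D. localizes \<phi> x)}"

definition is_baLc :: "(nat \<Rightarrow> nat) \<Rightarrow> (nat \<Rightarrow> nat) \<Rightarrow> (nat \<Rightarrow> nat set) rel \<Rightarrow> bool" where
  "is_baLc b h = isMinCard {|F| | F. F \<subseteq> slaloms b h \<and>
     \<not> (\<exists>y\<in>prodb b. \<forall>\<phi>\<in>F. antilocalizes \<phi> y)}"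

definition is_daLc :: "(nat \<Rightarrow> nat) \<Rightarrow> (nat \<Rightarrow> nat) \<Rightarrow> (nat \<Rightarrow> nat) rel \<Rightarrow> bool" where
  "is_daLc b h = isMinCard {|D| | D. D \<subseteq> prodb b \<and>
     (\<forall>\<phi>\<in>slaloms b h. \<exists>y\<in>D. antilocalizes \<phi> y)}"

definition minLc_h :: "(nat \<Rightarrow> nat) \<Rightarrow> (nat \<Rightarrow> nat) rel" where
  "minLc_h h = minCard {r. \<exists>b. (\<forall>\<^sub>\<infinity>n. h n < b n) \<and> is_bLc b h r}"

definition supLc_h :: "(nat \<Rightarrow> nat) \<Rightarrow> (nat \<Rightarrow> nat set) rel" where
  "supLc_h h = supCard {r. \<exists>b. (\<forall>\<^sub>\<infinity>n. h n < b n) \<and> is_dLc b h r}"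

definition supaLc_h :: "(nat \<Rightarrow> nat) \<Rightarrow> (nat \<Rightarrow> nat set) rel" where
  "supaLc_h h = supCard {r. \<exists>b. (\<forall>\<^sub>\<infinity>n. h n < b n) \<and> is_baLc b h r}"

definition minaLc_h :: "(nat \<Rightarrow> nat) \<Rightarrow> (nat \<Rightarrow> nat) rel" where
  "minaLc_h h = minCard {r. \<exists>b. (\<forall>\<^sub>\<infinity>n. h n < b n) \<and> is_daLc b h r}"

definition minLc :: "(nat \<Rightarrow> nat) rel" where
  "minLc = minLc_h id"

definition supLc :: "(nat \<Rightarrow> nat set) rel" where
  "supLc = supLc_h id"

definition supaLc :: "(nat \<Rightarrow> nat set) rel" where
  "supaLc = supaLc_h (\<lambda>_. 1)"

definition minaLc :: "(nat \<Rightarrow> nat) rel" where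
  "minaLc = minaLc_h (\<lambda>_. 1)"


text \<open>The choices above are determined up to \<open>=o\<close>, and the required objects exist.\<close>

lemma isMinCard_unique:
  assumes "isMinCard R r" "isMinCard R s"
  shows "r =o s"
  using assms by (auto simp: isMinCard_def ordIso_iff_ordLeq)

lemma isSupCard_unique:
  assumes "isSupCard R r" "isSupCard R s"
  shows "r =o s"
  using assms by (auto simp: isSupCard_def ordIso_iff_ordLeq)

lemma isMinCard_minCard:
  assumes "R \<noteq> {}" "\<forall>r\<in>R. Card_order r"
  shows "isMinCard R (minCard R)"
  unfolding minCard_def
  by (rule someI_ex) (use exists_minim_Card_order[OF assms] in \<open>auto simp: isMinCard_def\<close>)

lemma isMinCard_card_of_ex:
  assumes "P A"
  shows "\<exists>r. isMinCard {|F| | F. P F} r"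
proof -
  have "{|F| | F. P F} \<noteq> {}" "\<forall>r\<in>{|F| | F. P F}. Card_order r"
    using assms card_of_Card_order by auto
  from isMinCard_minCard[OF this] show ?thesis by blast
qed

lemma isSupCard_supCard:
  fixes R :: "'a rel set"
  assumes "\<forall>r\<in>R. Card_order r"
  shows "isSupCard R (supCard R)"
  unfolding supCard_def
proof (rule someI_ex)
  let ?U = "{u :: 'a rel. Card_order u \<and> (\<forall>s\<in>R. s \<le>o u)}"
  have "s \<le>o |UNIV :: 'a set|" if "s \<in> R" for s
  proof -
    have "s =o |Field s|"
      using assms that card_of_Field_ordIso ordIso_symmetric by blast
    also have "|Field s| \<le>o |UNIV :: 'a set|"
      by (rule card_of_mono1) simp
    finally show ?thesis .
  qed
  then have "?U \<noteq> {}"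
    using card_of_Card_order by blast
  moreover have "\<forall>u\<in>?U. Card_order u"
    by blast
  ultimately have "\<exists>u\<in>?U. \<forall>u'\<in>?U. u \<le>o u'"
    by (rule exists_minim_Card_order)
  then show "\<exists>r. isSupCard R r"
    unfolding isSupCard_def by blast
qed

lemma prodb_escape:
  assumes "\<forall>n. 0 < b n" "\<forall>\<^sub>\<infinity>n. h n < b n" "\<phi> \<in> slaloms b h"
  shows "\<exists>x\<in>prodb b. antilocalizes \<phi> x"
proof -
  have "\<exists>k<b n. h n < b n \<longrightarrow> k \<notin> \<phi> n" for n
  proof (cases "h n < b n")
    case True
    have "card (\<phi> n) < card {..<b n}"
      using True assms(3) by (auto simp: slaloms_def intro: le_less_trans)
    then have "\<not> {..<b n} \<subseteq> \<phi> n"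
      using assms(3) by (metis (mono_tags, lifting) less_irrefl mem_Collect_eq slaloms_def
          subset_antisym)
    then show ?thesis by auto
  next
    case False
    then show ?thesis using assms(1) by blast
  qed
  then obtain x where x: "\<And>n. x n < b n" "\<And>n. h n < b n \<Longrightarrow> x n \<notin> \<phi> n"
    by metis
  have "antilocalizes \<phi> x"
    unfolding antilocalizes_def using assms(2) x(2) by (rule MOST_mono)
  then show ?thesis using x(1) by (auto simp: prodb_def)
qed

lemma slalom_through:
  assumes "\<forall>\<^sub>\<infinity>n. 1 \<le> h n" "x \<in> prodb b"
  shows "\<exists>\<phi>\<in>slaloms b h. localizes \<phi> x"
proof
  let ?\<phi> = "\<lambda>n. if 1 \<le> h n then {x n} else {}"
  show "?\<phi> \<in> slaloms b h"
    using assms(2) by (auto simp: slaloms_def prodb_def)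
  show "localizes ?\<phi> x"
    unfolding localizes_def using assms(1) by (rule MOST_mono) auto
qed

lemma localizes_not_antilocalizes: "localizes \<phi> x \<Longrightarrow> \<not> antilocalizes \<phi> x"
  unfolding localizes_def antilocalizes_def
  by (auto dest: MOST_conjI)

lemma is_bLc_ex:
  assumes "\<forall>n. 0 < b n" "\<forall>\<^sub>\<infinity>n. h n < b n"
  shows "\<exists>r. is_bLc b h r"
  unfolding is_bLc_def
  by (rule isMinCard_card_of_ex[of _ "prodb b"])
    (use prodb_escape[OF assms] localizes_not_antilocalizes in blast)

lemma is_dLc_ex:
  assumes "\<forall>\<^sub>\<infinity>n. 1 \<le> h n"
  shows "\<exists>r. is_dLc b h r"
  unfolding is_dLc_def
  by (rule isMinCard_card_of_ex[of _ "slaloms b h"]) (use slalom_through[OF assms] in blast)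

lemma is_baLc_ex:
  assumes "\<forall>\<^sub>\<infinity>n. 1 \<le> h n"
  shows "\<exists>r. is_baLc b h r"
  unfolding is_baLc_def
  by (rule isMinCard_card_of_ex[of _ "slaloms b h"])
    (use slalom_through[OF assms] localizes_not_antilocalizes in blast)

lemma is_daLc_ex:
  assumes "\<forall>n. 0 < b n" "\<forall>\<^sub>\<infinity>n. h n < b n"
  shows "\<exists>r. is_daLc b h r"
  unfolding is_daLc_def
  by (rule isMinCard_card_of_ex[of _ "prodb b"]) (use prodb_escape[OF assms] in blast)

end

theory Submission
  imports Defs "HOL-Library.Nat_Bijection"
begin

text \<open>
  All four equalities come from Tukey connections between relational systems that change the
  function \<open>h\<close> at the cost of enlarging \<open>b\<close>. For localization, let \<open>N\<close> tend to infinity so slowly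
  that \<open>h' (N k) \<le> h k\<close>, and let \<open>x' n\<close> code the values \<open>x k\<close> for the finitely many \<open>k\<close> with
  \<open>N k = n\<close>; a slalom of width \<open>h'\<close> catching \<open>x'\<close> decodes to one of width \<open>h\<close> catching \<open>x\<close>.
  For anti-localization, let \<open>y' n\<close> code the values of \<open>y\<close> at \<open>h n\<close> places reserved for \<open>n\<close>.
  A slalom of width \<open>h\<close> offers at most \<open>h n\<close> guesses at \<open>y' n\<close>, and predicting \<open>y\<close> at the
  \<open>i\<close>-th place by the \<open>i\<close>-th guess gives a slalom of width 1 that meets \<open>y\<close> whenever the original
  one meets \<open>y'\<close>.
\<close>

section \<open>Relational systems, Tukey connections and comparison of cardinals\<close>

definition unbounded_cards :: "'a set \<Rightarrow> 'b set \<Rightarrow> ('a \<Rightarrow> 'b \<Rightarrow> bool) \<Rightarrow> 'a rel set" where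
  "unbounded_cards A B R = {|F| | F. F \<subseteq> A \<and> \<not> (\<exists>y\<in>B. \<forall>x\<in>F. R x y)}"

text \<open>The least element here is the dominating number of the relational system
  \<open>(A, B, R)\<close>; that of \<open>unbounded_cards\<close> is its bounding number.\<close>

definition dominating_cards :: "'a set \<Rightarrow> 'b set \<Rightarrow> ('a \<Rightarrow> 'b \<Rightarrow> bool) \<Rightarrow> 'b rel set" where
  "dominating_cards A B R = {|D| | D. D \<subseteq> B \<and> (\<forall>x\<in>A. \<exists>y\<in>D. R x y)}"

definition tukey_below ::
    "'a set \<Rightarrow> 'b set \<Rightarrow> ('a \<Rightarrow> 'b \<Rightarrow> bool) \<Rightarrow> 'c set \<Rightarrow> 'd set \<Rightarrow> ('c \<Rightarrow> 'd \<Rightarrow> bool) \<Rightarrow> bool" where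
  "tukey_below A B R A' B' R' \<longleftrightarrow> (\<exists>f g. f ` A \<subseteq> A' \<and> g ` B' \<subseteq> B \<and>
     (\<forall>x\<in>A. \<forall>y\<in>B'. R' (f x) y \<longrightarrow> R x (g y)))"

lemma is_bLc_eq:
  "is_bLc b h = isMinCard (unbounded_cards (prodb b) (slaloms b h) (\<lambda>x \<phi>. localizes \<phi> x))"
  by (simp add: is_bLc_def unbounded_cards_def)

lemma is_dLc_eq:
  "is_dLc b h = isMinCard (dominating_cards (prodb b) (slaloms b h) (\<lambda>x \<phi>. localizes \<phi> x))"
  by (simp add: is_dLc_def dominating_cards_def)

text \<open>Slaloms are now the challenges, so widening them makes the system harder to answer,
  opposite to localization.\<close>

lemma is_baLc_eq:
  "is_baLc b h = isMinCard (unbounded_cards (slaloms b h) (prodb b) antilocalizes)"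
  by (simp add: is_baLc_def unbounded_cards_def)

lemma is_daLc_eq:
  "is_daLc b h = isMinCard (dominating_cards (slaloms b h) (prodb b) antilocalizes)"
  by (simp add: is_daLc_def dominating_cards_def)

lemma Card_order_unbounded_cards: "isMinCard (unbounded_cards A B R) r \<Longrightarrow> Card_order r"
  by (auto simp: isMinCard_def unbounded_cards_def card_of_Card_order)

lemma Card_order_dominating_cards: "isMinCard (dominating_cards A B R) r \<Longrightarrow> Card_order r"
  by (auto simp: isMinCard_def dominating_cards_def card_of_Card_order)

text \<open>Existence is part of the conclusion because a least size need not exist in general; the
  element of \<open>S\<close> found below \<open>r\<close> shows that \<open>S\<close> is
  nonempty.\<close>

lemma isMinCard_transfer:
  assumes "isMinCard R r" "\<forall>r\<in>R. \<exists>s\<in>S. s \<le>o r" "\<forall>s\<in>S. Card_order s"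
  shows "\<exists>s. isMinCard S s \<and> s \<le>o r"
proof -
  obtain s where s: "s \<in> S" "s \<le>o r"
    using assms(1,2) by (auto simp: isMinCard_def)
  have "isMinCard S (minCard S)"
    using s(1) assms(3) by (intro isMinCard_minCard) auto
  moreover have "minCard S \<le>o r"
    using calculation s ordLeq_transitive unfolding isMinCard_def by blast
  ultimately show ?thesis by blast
qed

text \<open>A common bound \<open>y\<close> for the image of \<open>F\<close> under \<open>f\<close>
  would yield the common bound \<open>g y\<close> for \<open>F\<close>, so \<open>f\<close>
  preserves unbounded families and does not enlarge them.\<close>

lemma tukey_below_unbounded:
  fixes A A' :: "'a set"
  assumes "tukey_below A B R A' B' R'" "isMinCard (unbounded_cards A B R) r"
  shows "\<exists>r'. isMinCard (unbounded_cards A' B' R') r' \<and> r' \<le>o r"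
proof (rule isMinCard_transfer[OF assms(2)])
  obtain f g where fg: "f ` A \<subseteq> A'" "g ` B' \<subseteq> B"
      "\<forall>x\<in>A. \<forall>y\<in>B'. R' (f x) y \<longrightarrow> R x (g y)"
    using assms(1) unfolding tukey_below_def by (elim exE conjE) (rule that)
  show "\<forall>r\<in>unbounded_cards A B R. \<exists>s\<in>unbounded_cards A' B' R'. s \<le>o r"
  proof
    fix r assume "r \<in> unbounded_cards A B R"
    then obtain F where F: "r = |F|" "F \<subseteq> A" "\<not> (\<exists>y\<in>B. \<forall>x\<in>F. R x y)"
      unfolding unbounded_cards_def by blast
    have "\<not> (\<exists>y\<in>B'. \<forall>x\<in>f ` F. R' x y)"
    proof
      assume "\<exists>y\<in>B'. \<forall>x\<in>f ` F. R' x y"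
      then obtain y where "y \<in> B'" "\<forall>x\<in>F. R' (f x) y" by blast
      then have "g y \<in> B" "\<forall>x\<in>F. R x (g y)"
        using fg(2,3) F(2) by auto
      then show False using F(3) by blast
    qed
    then have "|f ` F| \<in> unbounded_cards A' B' R'"
      using F(2) fg(1) unfolding unbounded_cards_def by blast
    then show "\<exists>s\<in>unbounded_cards A' B' R'. s \<le>o r"
      using F(1) card_of_image by blast
  qed
qed (auto simp: unbounded_cards_def card_of_Card_order)

text \<open>Dually, \<open>g\<close> preserves dominating families: if \<open>y\<close> answers
  \<open>f x\<close>, then \<open>g y\<close> answers \<open>x\<close>.\<close>

lemma tukey_below_dominating:
  fixes B B' :: "'b set"
  assumes "tukey_below A B R A' B' R'" "isMinCard (dominating_cards A' B' R') r"
  shows "\<exists>s. isMinCard (dominating_cards A B R) s \<and> s \<le>o r"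
proof (rule isMinCard_transfer[OF assms(2)])
  obtain f g where fg: "f ` A \<subseteq> A'" "g ` B' \<subseteq> B"
      "\<forall>x\<in>A. \<forall>y\<in>B'. R' (f x) y \<longrightarrow> R x (g y)"
    using assms(1) unfolding tukey_below_def by (elim exE conjE) (rule that)
  show "\<forall>r\<in>dominating_cards A' B' R'. \<exists>s\<in>dominating_cards A B R. s \<le>o r"
  proof
    fix r assume "r \<in> dominating_cards A' B' R'"
    then obtain D where D: "r = |D|" "D \<subseteq> B'" "\<forall>x\<in>A'. \<exists>y\<in>D. R' x y"
      unfolding dominating_cards_def by blast
    have "\<forall>x\<in>A. \<exists>y\<in>g ` D. R x y"
    proof
      fix x assume x: "x \<in> A"
      then obtain y where "y \<in> D" "R' (f x) y"
        using D(3) fg(1) by blast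
      then show "\<exists>y\<in>g ` D. R x y"
        using x D(2) fg(3) by blast
    qed
    then have "|g ` D| \<in> dominating_cards A B R"
      using D(2) fg(2) unfolding dominating_cards_def by blast
    then show "\<exists>s\<in>dominating_cards A B R. s \<le>o r"
      using D(1) card_of_image by blast
  qed
qed (auto simp: dominating_cards_def card_of_Card_order)

text \<open>Each set is coinitial with the other. Nonemptiness matters because
  \<open>minCard\<close> of an empty set is an arbitrary relation.\<close>

lemma minCard_ordIso:
  assumes "R \<noteq> {}" "\<forall>r\<in>R. Card_order r" "\<forall>s\<in>S. Card_order s"
    and "\<forall>r\<in>R. \<exists>s\<in>S. s \<le>o r" "\<forall>s\<in>S. \<exists>r\<in>R. r \<le>o s"
  shows "minCard R =o minCard S"
proof -
  have "S \<noteq> {}"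
    using assms(1,4) by blast
  then have "isMinCard R (minCard R)" "isMinCard S (minCard S)"
    using assms(1-3) isMinCard_minCard by blast+
  then show ?thesis
    using assms(4,5) ordLeq_transitive unfolding isMinCard_def ordIso_iff_ordLeq by meson
qed

text \<open>Each supremum bounds the other set by cofinality. Both sets live on one type, since
  \<open>isSupCard\<close> compares only with upper bounds on that type.\<close>

lemma supCard_ordIso:
  fixes R S :: "'a rel set"
  assumes "\<forall>r\<in>R. Card_order r" "\<forall>s\<in>S. Card_order s"
    and "\<forall>r\<in>R. \<exists>s\<in>S. r \<le>o s" "\<forall>s\<in>S. \<exists>r\<in>R. s \<le>o r"
  shows "supCard R =o supCard S"
proof -
  have sups: "isSupCard R (supCard R)" "isSupCard S (supCard S)"
    using assms(1,2) isSupCard_supCard by blast+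
  have "\<forall>r\<in>R. r \<le>o supCard S" "\<forall>s\<in>S. s \<le>o supCard R"
    using sups assms(3,4) ordLeq_transitive unfolding isSupCard_def by blast+
  then have "supCard R \<le>o supCard S" "supCard S \<le>o supCard R"
    using sups unfolding isSupCard_def by simp_all
  then show ?thesis by (simp add: ordIso_iff_ordLeq)
qed

section \<open>Coding initial segments by numbers\<close>

definition seg_code :: "nat \<Rightarrow> (nat \<Rightarrow> nat) \<Rightarrow> nat" where
  "seg_code l x = list_encode (map x [0..<l])"

text \<open>Because whole initial segments are coded, list position and argument agree, and decoding
  does not depend on the length of the segment.\<close>

definition seg_value :: "nat \<Rightarrow> nat \<Rightarrow> nat" where
  "seg_value c k = list_decode c ! k"

lemma seg_value_seg_code: "k < l \<Longrightarrow> seg_value (seg_code l x) k = x k"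
  by (simp add: seg_value_def seg_code_def)

text \<open>Below \<open>l\<close> the values lie under the common bound
  \<open>sum b {..<l}\<close>, so only finitely many initial segments occur.\<close>

lemma seg_code_bounded: "\<exists>c. \<forall>x\<in>prodb b. seg_code l x < c"
proof -
  let ?L = "{xs. set xs \<subseteq> {..<sum b {..<l}} \<and> length xs = l}"
  have "finite (list_encode ` ?L)"
    by (intro finite_imageI finite_lists_length_eq) simp
  then obtain c where c: "\<forall>i\<in>list_encode ` ?L. i < c"
    using finite_nat_set_iff_bounded by blast
  have "seg_code l x < c" if "x \<in> prodb b" for x
  proof -
    have "x k < sum b {..<l}" if "k < l" for k
    proof -
      have "b k \<le> sum b {..<l}"
        using that by (intro member_le_sum) auto
      then show ?thesis
        using \<open>x \<in> prodb b\<close> by (auto simp: prodb_def intro: less_le_trans)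
    qed
    then have "map x [0..<l] \<in> ?L" by auto
    then show ?thesis
      using c unfolding seg_code_def by blast
  qed
  then show ?thesis by blast
qed

lemma prodb_seg_code_ex:
  obtains b' where "\<forall>n. h n < b' n" "\<forall>x\<in>prodb b. (\<lambda>n. seg_code (l n) x) \<in> prodb b'"
proof -
  have "\<forall>n. \<exists>c. \<forall>x\<in>prodb b. seg_code (l n) x < c"
    using seg_code_bounded by blast
  from choice[OF this] obtain c where c: "\<forall>n. \<forall>x\<in>prodb b. seg_code (l n) x < c n" ..
  show thesis
  \<comment> \<open>One summand makes the new bound exceed \<open>h\<close>, the other makes room
    for the codes.\<close>
  proof (rule that[of "\<lambda>n. Suc (h n) + c n"])
    show "\<forall>x\<in>prodb b. (\<lambda>n. seg_code (l n) x) \<in> prodb (\<lambda>n. Suc (h n) + c n)"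
    proof
      fix x assume "x \<in> prodb b"
      then have "seg_code (l n) x < Suc (h n) + c n" for n
        using c by (intro trans_less_add2) blast
      then show "(\<lambda>n. seg_code (l n) x) \<in> prodb (\<lambda>n. Suc (h n) + c n)"
        by (simp add: prodb_def)
    qed
  qed simp
qed

section \<open>The Tukey connection for localization\<close>

lemma slow_reindexing_ex:
  assumes "filterlim h at_top sequentially"
  obtains N :: "nat \<Rightarrow> nat" where "filterlim N at_top sequentially" "\<forall>\<^sub>\<infinity>k. (h' (N k) :: nat) \<le> h k"
proof -
  \<comment> \<open>\<open>N k\<close> is the largest \<open>n \<le> k\<close> with
    \<open>h' n \<le> h k\<close>. As \<open>h\<close> diverges, every fixed \<open>n\<close>
    eventually qualifies, hence \<open>N\<close> diverges too.\<close>
  define S where "S k = {n. n \<le> k \<and> h' n \<le> h k}" for k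
  define N where "N k = Max (S k)" for k
  have fin: "finite (S k)" for k
    unfolding S_def by (rule finite_subset[of _ "{..k}"]) auto
  have ev: "eventually (\<lambda>k. n \<in> S k) sequentially" for n
    using eventually_ge_at_top[of n] assms[unfolded filterlim_at_top, rule_format, of "h' n"]
    by eventually_elim (simp add: S_def)
  have "filterlim N at_top sequentially"
    unfolding filterlim_at_top
  proof
    fix n show "eventually (\<lambda>k. n \<le> N k) sequentially"
      using ev[of n] by eventually_elim (simp add: N_def fin)
  qed
  \<comment> \<open>\<open>S k\<close> can be empty, where \<open>Max\<close> says nothing; from the
    point on where 0 belongs to it, the maximum is attained.\<close>
  moreover have "\<forall>\<^sub>\<infinity>k. h' (N k) \<le> h k"
    using ev[of 0] unfolding cofinite_eq_sequentially
  proof eventually_elim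
    case (elim k)
    then have "N k \<in> S k"
      unfolding N_def using fin by (intro Max_in) auto
    then show ?case by (simp add: S_def)
  qed
  ultimately show thesis by (rule that)
qed

lemma tukey_below_localization:
  assumes "filterlim h at_top sequentially"
  shows "\<exists>b'. (\<forall>n. h' n < b' n) \<and>
    tukey_below (prodb b) (slaloms b h) (\<lambda>x \<phi>. localizes \<phi> x)
      (prodb b') (slaloms b' h') (\<lambda>x \<phi>. localizes \<phi> x)"
proof -
  obtain N where N: "filterlim N at_top sequentially" "\<forall>\<^sub>\<infinity>k. h' (N k) \<le> h k"
    using slow_reindexing_ex[OF assms] .
  \<comment> \<open>Divergence of \<open>N\<close> makes its fibres finite, so an initial segment of
    length \<open>l n\<close> covers the fibre over \<open>n\<close>.\<close>
  have "\<exists>l. \<forall>k. N k = n \<longrightarrow> k < l" for n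
  proof -
    obtain l where "\<forall>k\<ge>l. Suc n \<le> N k"
      using N(1) unfolding filterlim_at_top eventually_sequentially by blast
    then show ?thesis by (metis not_less not_less_eq_eq order_refl)
  qed
  then obtain l where l: "\<And>k. k < l (N k)" by metis
  obtain b' where b': "\<forall>n. h' n < b' n" "\<forall>x\<in>prodb b. (\<lambda>n. seg_code (l n) x) \<in> prodb b'"
    by (rule prodb_seg_code_ex)
  define f where "f x n = seg_code (l n) x" for x n
  \<comment> \<open>Every guess at the code is decoded at \<open>k\<close>. The intersection removes
    values out of range, and the empty default at the finitely many bad \<open>k\<close> keeps the
    width below \<open>h\<close> everywhere.\<close>
  define g :: "(nat \<Rightarrow> nat set) \<Rightarrow> nat \<Rightarrow> nat set" where
    "g \<phi> k = (if h' (N k) \<le> h k then (\<lambda>c. seg_value c k) ` \<phi> (N k) \<inter> {..<b k} else {})" for \<phi> k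
  have "f ` prodb b \<subseteq> prodb b'"
    using b'(2) by (auto simp: f_def [abs_def])
  moreover have "g ` slaloms b' h' \<subseteq> slaloms b h"
  proof (clarsimp simp: slaloms_def)
    fix \<phi> k assume \<phi>: "\<forall>n. \<phi> n \<subseteq> {..<b' n} \<and> card (\<phi> n) \<le> h' n"
    have fin: "finite (\<phi> (N k))"
      using \<phi> finite_subset by blast
    have "card (g \<phi> k) \<le> h k" if "h' (N k) \<le> h k"
    proof -
      have "card (g \<phi> k) \<le> card ((\<lambda>c. seg_value c k) ` \<phi> (N k))"
        using that fin by (auto simp: g_def intro: card_mono)
      also have "\<dots> \<le> card (\<phi> (N k))"
        by (rule card_image_le[OF fin])
      also have "\<dots> \<le> h k"
        using \<phi> that order_trans by blast
      finally show ?thesis .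
    qed
    then show "g \<phi> k \<subseteq> {..<b k} \<and> card (g \<phi> k) \<le> h k"
      by (auto simp: g_def)
  qed
  moreover have "localizes (g \<phi>) x" if "x \<in> prodb b" "localizes \<phi> (f x)" for x \<phi>
  proof -
    \<comment> \<open>Capture at almost all \<open>n\<close> becomes capture at \<open>N k\<close>
      for almost all \<open>k\<close>, as \<open>N\<close> diverges.\<close>
    have "eventually (\<lambda>k. f x (N k) \<in> \<phi> (N k)) sequentially"
      using eventually_compose_filterlim[OF _ N(1)] that(2)
      unfolding localizes_def cofinite_eq_sequentially by blast
    then show ?thesis
      using N(2) unfolding localizes_def cofinite_eq_sequentially
    proof eventually_elim
      case (elim k)
      have "x k = seg_value (f x (N k)) k"
        by (simp add: f_def seg_value_seg_code l)
      moreover have "x k < b k"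
        using that(1) by (simp add: prodb_def)
      ultimately show ?case
        using elim by (auto simp: g_def)
    qed
  qed
  ultimately show ?thesis
    using b'(1) unfolding tukey_below_def by blast
qed

section \<open>The Tukey connections for anti-localization\<close>

lemma tukey_below_antilocalization_one:
  "\<exists>b'. (\<forall>n. h n < b' n) \<and>
    tukey_below (slaloms b' h) (prodb b') antilocalizes (slaloms b (\<lambda>_. 1)) (prodb b) antilocalizes"
proof -
  \<comment> \<open>The places reserved for \<open>n\<close> are \<open>prod_encode (n, i)\<close>
    with \<open>i < h n\<close>; different \<open>n\<close> get disjoint blocks.\<close>
  have "\<exists>l. \<forall>i<h n. prod_encode (n, i) < l" for n
  proof -
    have "finite ((\<lambda>i. prod_encode (n, i)) ` {..<h n})" by simp
    then show ?thesis
      unfolding finite_nat_set_iff_bounded by auto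
  qed
  then obtain l where l: "\<And>n i. i < h n \<Longrightarrow> prod_encode (n, i) < l n" by metis
  obtain b' where b': "\<forall>n. h n < b' n" "\<forall>x\<in>prodb b. (\<lambda>n. seg_code (l n) x) \<in> prodb b'"
    by (rule prodb_seg_code_ex)
  define g where "g y n = seg_code (l n) y" for y n
  \<comment> \<open>If \<open>i\<close> exceeds the number of guesses, the list entry is
    unspecified, but the set still has at most one element and lies below
    \<open>b k\<close>.\<close>
  define f :: "(nat \<Rightarrow> nat set) \<Rightarrow> nat \<Rightarrow> nat set" where
    "f \<phi> k = (case prod_decode k of (n, i) \<Rightarrow>
       {seg_value (sorted_list_of_set (\<phi> n) ! i) k} \<inter> {..<b k})" for \<phi> k
  have "f ` slaloms b' h \<subseteq> slaloms b (\<lambda>_. 1)"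
  proof (clarsimp simp: slaloms_def)
    fix \<phi> :: "nat \<Rightarrow> nat set" and k
    have "card ({v} \<inter> {..<b k}) \<le> Suc 0" for v
      using card_mono[of "{v}" "{v} \<inter> {..<b k}"] by simp
    then show "f \<phi> k \<subseteq> {..<b k} \<and> card (f \<phi> k) \<le> Suc 0"
      by (auto simp: f_def split: prod.split)
  qed
  moreover have "g ` prodb b \<subseteq> prodb b'"
    using b'(2) by (auto simp: g_def [abs_def])
  moreover have "antilocalizes \<phi> (g y)"
    if \<phi>: "\<phi> \<in> slaloms b' h" and y: "y \<in> prodb b" and anti: "antilocalizes (f \<phi>) y" for \<phi> y
  proof -
    obtain k0 where k0: "\<forall>k\<ge>k0. y k \<notin> f \<phi> k"
      using anti unfolding antilocalizes_def MOST_nat_le by blast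
    have "g y n \<notin> \<phi> n" if "k0 \<le> n" for n
    proof
      assume mem: "g y n \<in> \<phi> n"
      have "\<phi> n \<subseteq> {..<b' n}" and card: "card (\<phi> n) \<le> h n"
        using \<phi> by (auto simp: slaloms_def)
      then have fin: "finite (\<phi> n)"
        using finite_subset by blast
      \<comment> \<open>The code \<open>g y n\<close> is the \<open>i\<close>-th guess, so the
        prediction at the \<open>i\<close>-th reserved place \<open>k\<close> is correct. Since
        \<open>k \<ge> n \<ge> k0\<close>, this contradicts the choice of \<open>k0\<close>.\<close>
      obtain i where i: "i < card (\<phi> n)" "sorted_list_of_set (\<phi> n) ! i = g y n"
        using mem fin by (metis in_set_conv_nth length_sorted_list_of_set set_sorted_list_of_set)
      define k where "k = prod_encode (n, i)"
      have "seg_value (g y n) k = y k"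
        unfolding g_def k_def using i(1) card by (intro seg_value_seg_code l) simp
      then have "y k \<in> f \<phi> k"
        using i(2) y by (simp add: f_def k_def prodb_def)
      moreover have "k0 \<le> k"
        using that le_prod_encode_1 order_trans unfolding k_def by blast
      ultimately show False using k0 by blast
    qed
    then show ?thesis
      unfolding antilocalizes_def MOST_nat_le by blast
  qed
  ultimately show ?thesis
    using b'(1) unfolding tukey_below_def by blast
qed

text \<open>A slalom of width 1 has width \<open>h\<close> after being emptied where
  \<open>h n = 0\<close>, and these finitely many places do not affect anti-localization.\<close>

lemma tukey_below_antilocalization_mono:
  assumes "\<forall>\<^sub>\<infinity>n. 1 \<le> h n"
  shows "tukey_below (slaloms b (\<lambda>_. 1)) (prodb b) antilocalizes (slaloms b h) (prodb b) antilocalizes"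
proof -
  define f :: "(nat \<Rightarrow> nat set) \<Rightarrow> nat \<Rightarrow> nat set" where
    "f \<phi> n = (if 1 \<le> h n then \<phi> n else {})" for \<phi> n
  have "f ` slaloms b (\<lambda>_. 1) \<subseteq> slaloms b h"
    by (fastforce simp: slaloms_def f_def intro: order_trans)
  moreover have "antilocalizes \<phi> y" if "antilocalizes (f \<phi>) y" for \<phi> y
    using assms that unfolding antilocalizes_def
    by eventually_elim (simp add: f_def)
  ultimately show ?thesis
    unfolding tukey_below_def by (intro exI[of _ f] exI[of _ id]) auto
qed

section \<open>Independence of the four cardinals from \<open>h\<close>\<close>

lemma filterlim_at_top_MOST_ge_1:
  "filterlim (h :: nat \<Rightarrow> nat) at_top sequentially \<Longrightarrow> \<forall>\<^sub>\<infinity>n. 1 \<le> h n"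
  by (simp add: filterlim_at_top cofinite_eq_sequentially)

lemma minLc_h_ordIso:
  assumes "filterlim h at_top sequentially" "filterlim h' at_top sequentially"
  shows "minLc_h h =o minLc_h h'"
proof -
  \<comment> \<open>Stated for arbitrary \<open>h\<close> and \<open>h'\<close>, as it is applied
    again with the two exchanged.\<close>
  have transfer: "\<exists>s. (\<exists>b. (\<forall>\<^sub>\<infinity>n. h' n < b n) \<and> is_bLc b h' s) \<and> s \<le>o r"
    if h: "filterlim h at_top sequentially" and r: "is_bLc b h r" for h h' b r
  proof -
    obtain b' where b': "\<forall>n. h' n < b' n"
        "tukey_below (prodb b) (slaloms b h) (\<lambda>x \<phi>. localizes \<phi> x)
          (prodb b') (slaloms b' h') (\<lambda>x \<phi>. localizes \<phi> x)"
      using tukey_below_localization[OF h] by blast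
    then show ?thesis
      using tukey_below_unbounded[OF b'(2)] r ALL_MOST unfolding is_bLc_eq by blast
  qed
  \<comment> \<open>An everywhere positive admissible bound witnesses that the minimum is over a
    nonempty set.\<close>
  have "\<exists>r. is_bLc (\<lambda>n. Suc (h n)) h r"
    by (rule is_bLc_ex) auto
  moreover have "\<forall>\<^sub>\<infinity>n. h n < Suc (h n)" by simp
  ultimately have "\<exists>r b. (\<forall>\<^sub>\<infinity>n. h n < b n) \<and> is_bLc b h r"
    by (elim exE) (intro exI conjI)
  then show ?thesis
    unfolding minLc_h_def using transfer assms
    by (intro minCard_ordIso) (auto simp: is_bLc_eq dest: Card_order_unbounded_cards)
qed

lemma supLc_h_ordIso:
  assumes "filterlim h at_top sequentially" "filterlim h' at_top sequentially"
  shows "supLc_h h =o supLc_h h'"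
proof -
  have transfer: "\<exists>s. (\<exists>b. (\<forall>\<^sub>\<infinity>n. h' n < b n) \<and> is_dLc b h' s) \<and> r \<le>o s"
    if h: "filterlim h at_top sequentially" "filterlim h' at_top sequentially"
      and r: "is_dLc b h r" for h h' b r
  proof -
    obtain b' where b': "\<forall>n. h' n < b' n"
        "tukey_below (prodb b) (slaloms b h) (\<lambda>x \<phi>. localizes \<phi> x)
          (prodb b') (slaloms b' h') (\<lambda>x \<phi>. localizes \<phi> x)"
      using tukey_below_localization[OF h(1)] by blast
    \<comment> \<open>The transfer of dominating numbers starts from an existing minimum on the
      larger side; it exists because \<open>h'\<close> is eventually positive.\<close>
    obtain s where s: "is_dLc b' h' s"
      using is_dLc_ex filterlim_at_top_MOST_ge_1[OF h(2)] by blast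
    obtain r' where r': "is_dLc b h r'" "r' \<le>o s"
      using tukey_below_dominating[OF b'(2)] s unfolding is_dLc_eq by blast
    have "r \<le>o s"
      using isMinCard_unique r r' ordIso_ordLeq_trans unfolding is_dLc_def by blast
    then show ?thesis using s b'(1) ALL_MOST by blast
  qed
  show ?thesis
    unfolding supLc_h_def using transfer assms
    by (intro supCard_ordIso) (auto simp: is_dLc_eq dest: Card_order_dominating_cards)
qed

lemma supaLc_h_ordIso:
  assumes "\<forall>\<^sub>\<infinity>n. 1 \<le> h n"
  shows "supaLc_h h =o supaLc_h (\<lambda>_. 1)"
proof -
  \<comment> \<open>Passing from \<open>h\<close> to width 1 keeps \<open>b\<close>, which stays
    admissible by \<open>1 \<le> h n < b n\<close>; the converse \<open>up\<close> needs the coded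
    bound \<open>b'\<close>.\<close>
  have down: "\<exists>s. (\<exists>b. (\<forall>\<^sub>\<infinity>n. 1 < b n) \<and> is_baLc b (\<lambda>_. 1) s) \<and> r \<le>o s"
    if b: "\<forall>\<^sub>\<infinity>n. h n < b n" and r: "is_baLc b h r" for b r
  proof -
    obtain s where s: "is_baLc b (\<lambda>_. 1) s"
      using is_baLc_ex[of "\<lambda>_. 1" b] by auto
    obtain r' where r': "is_baLc b h r'" "r' \<le>o s"
      using tukey_below_unbounded[OF tukey_below_antilocalization_mono[OF assms]] s
      unfolding is_baLc_eq by blast
    have "r \<le>o s"
      using isMinCard_unique r r' ordIso_ordLeq_trans unfolding is_baLc_def by blast
    moreover have "\<forall>\<^sub>\<infinity>n. 1 < b n"
      using assms b by eventually_elim simp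
    ultimately show ?thesis using s by blast
  qed
  have up: "\<exists>s. (\<exists>b. (\<forall>\<^sub>\<infinity>n. h n < b n) \<and> is_baLc b h s) \<and> r \<le>o s"
    if r: "is_baLc b (\<lambda>_. 1) r" for b r
  proof -
    obtain b' where b': "\<forall>n. h n < b' n" "tukey_below (slaloms b' h) (prodb b') antilocalizes
        (slaloms b (\<lambda>_. 1)) (prodb b) antilocalizes"
      using tukey_below_antilocalization_one by blast
    obtain s where s: "is_baLc b' h s"
      using is_baLc_ex[OF assms] by blast
    obtain r' where r': "is_baLc b (\<lambda>_. 1) r'" "r' \<le>o s"
      using tukey_below_unbounded[OF b'(2)] s unfolding is_baLc_eq by blast
    have "r \<le>o s"
      using isMinCard_unique r r' ordIso_ordLeq_trans unfolding is_baLc_def by blast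
    then show ?thesis using s b'(1) ALL_MOST by blast
  qed
  show ?thesis
    unfolding supaLc_h_def using up down
    by (intro supCard_ordIso) (auto simp: is_baLc_eq dest: Card_order_unbounded_cards)
qed

lemma minaLc_h_ordIso:
  assumes "\<forall>\<^sub>\<infinity>n. 1 \<le> h n"
  shows "minaLc_h h =o minaLc_h (\<lambda>_. 1)"
proof -
  \<comment> \<open>The same two connections serve here, read through dominating instead of bounding
    numbers.\<close>
  have down: "\<exists>s. (\<exists>b. (\<forall>\<^sub>\<infinity>n. 1 < b n) \<and> is_daLc b (\<lambda>_. 1) s) \<and> s \<le>o r"
    if b: "\<forall>\<^sub>\<infinity>n. h n < b n" and r: "is_daLc b h r" for b r
  proof -
    obtain s where "is_daLc b (\<lambda>_. 1) s" "s \<le>o r"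
      using tukey_below_dominating[OF tukey_below_antilocalization_mono[OF assms]] r
      unfolding is_daLc_eq by blast
    moreover have "\<forall>\<^sub>\<infinity>n. 1 < b n"
      using assms b by eventually_elim simp
    ultimately show ?thesis by blast
  qed
  have up: "\<exists>s. (\<exists>b. (\<forall>\<^sub>\<infinity>n. h n < b n) \<and> is_daLc b h s) \<and> s \<le>o r"
    if r: "is_daLc b (\<lambda>_. 1) r" for b r
  proof -
    obtain b' where b': "\<forall>n. h n < b' n" "tukey_below (slaloms b' h) (prodb b') antilocalizes
        (slaloms b (\<lambda>_. 1)) (prodb b) antilocalizes"
      using tukey_below_antilocalization_one by blast
    then show ?thesis
      using tukey_below_dominating[OF b'(2)] r ALL_MOST unfolding is_daLc_eq by blast
  qed
  have "\<exists>r. is_daLc (\<lambda>n. Suc (h n)) h r"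
    by (rule is_daLc_ex) auto
  moreover have "\<forall>\<^sub>\<infinity>n. h n < Suc (h n)" by simp
  ultimately have "\<exists>r b. (\<forall>\<^sub>\<infinity>n. h n < b n) \<and> is_daLc b h r"
    by (elim exE) (intro exI conjI)
  then show ?thesis
    unfolding minaLc_h_def using up down
    by (intro minCard_ordIso) (auto simp: is_daLc_eq dest: Card_order_dominating_cards)
qed

theorem theorem3p19:
  fixes h :: "nat \<Rightarrow> nat"
  shows "(filterlim h at_top sequentially \<longrightarrow> minLc_h h =o minLc \<and> supLc_h h =o supLc) \<and>
    ((\<forall>\<^sub>\<infinity>n. 1 \<le> h n) \<longrightarrow> supaLc_h h =o supaLc \<and> minaLc_h h =o minaLc)"
proof -
  have "filterlim (id :: nat \<Rightarrow> nat) at_top sequentially"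
    unfolding id_def by (rule filterlim_ident)
  then show ?thesis
    unfolding minLc_def supLc_def supaLc_def minaLc_def
    using minLc_h_ordIso supLc_h_ordIso supaLc_h_ordIso minaLc_h_ordIso by blast
qed

end
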